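(* Let $X$ be a Banach space of analytic functions on $\mathbb{D}$ and let $T\in\mathcal{L}(H(\mathbb{D}))$ satisfy $T(X)\subseteq X$, in which case $T\in\mathcal{L}(X)$ (i.e. the restriction $T\colon X\to X$ is continuous for $\|\cdot\|_X$). Let $[T,X]$ be the optimal domain of $T$ with its semi-norm $\|\cdot\|_{[T,X]}$. Then the following properties hold. (i) $[T,X]\subseteq H(\mathbb{D})$. (ii) If $T\in\mathcal{L}(H(\mathbb{D}))$ is injective, then $([T,X],\|\cdot\|_{[T,X]})$ is a normed space. (iii) $X\subseteq [T,X]$, with a continuous inclusion from $X$ into the semi-normed space $[T,X]$. (iv) The operator $T_{[T,X]}\colon [T,X]\to X$, defined by $f\mapsto Tf$, is linear and continuous from the semi-normed space $[T,X]$ into $X$. (v) Let $Y$ be a closed subspace of $X$ satisfying $T(Y)\subseteq Y$. Then $Y$ (with the norm $\|\cdot\|_X$) is a Banach space of analytic functions on $\mathbb{D}$ and $[T,Y]$ is a closed subspace of $[T,X]$. (vi) $\mathrm{Ker}(T_X)=X\cap\mathrm{Ker}(T_{[T,X]})\subseteq \mathrm{Ker}(T_{[T,X]})\subseteq\mathrm{Ker}(T)$, where $T_X\colon X\to X$ is the restriction of $T$ to $X$, and where $\mathrm{Ker}(T)$ is the kernel of $T\in\mathcal{L}(H(\mathbb{D}))$.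
   Context: $\mathbb{D}$ is the open unit disc in $\mathbb{C}$; $H(\mathbb{D})$ is the Fréchet space of all analytic functions on $\mathbb{D}$ with the topology of uniform convergence on compact subsets of $\mathbb{D}$; $\mathcal{L}(E)$ denotes the space of continuous linear operators from $E$ into itself. A Banach space of analytic functions on $\mathbb{D}$ is a vector subspace $X\subseteq H(\mathbb{D})$ which is a Banach space for a norm $\|\cdot\|_X$ and such that the natural inclusion $X\to H(\mathbb{D})$ is continuous. For $T\in\mathcal{L}(H(\mathbb{D}))$ with $T(X)\subseteq X$, the optimal domain is $[T,X]:=\{f\in H(\mathbb{D}): Tf\in X\}$, endowed with the semi-norm $\|f\|_{[T,X]}:=\|Tf\|_X$. *)

theory Defs
  imports "HOL-Analysis.Analysis" "HOL-Library.Function_Algebras"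
begin

definition cscale :: "complex \<Rightarrow> (complex \<Rightarrow> complex) \<Rightarrow> complex \<Rightarrow> complex" where
  "cscale c f = (\<lambda>z. c * f z)"

interpretation cfun: vector_space cscale
  by unfold_locales (auto simp: cscale_def fun_eq_iff algebra_simps)

text \<open>
  Analytic functions on the open unit disc. A function on the disc is represented by its
  extension by zero, so that equality of functions is equality on the disc.
\<close>
definition H_disc :: "(complex \<Rightarrow> complex) set" where
  "H_disc = {f. f holomorphic_on ball 0 1 \<and> (\<forall>z. z \<notin> ball 0 1 \<longrightarrow> f z = 0)}"

lemma subspace_H_disc: "cfun.subspace H_disc"
  unfolding cfun.subspace_def H_disc_def
  by (auto simp: cscale_def zero_fun_def plus_fun_def intro!: holomorphic_intros)

text \<open>The topology of uniform convergence on compact subsets of the disc.\<close>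
definition open_H_disc :: "(complex \<Rightarrow> complex) set \<Rightarrow> bool" where
  "open_H_disc U \<longleftrightarrow> U \<subseteq> H_disc \<and>
     (\<forall>f\<in>U. \<exists>K e. compact K \<and> K \<subseteq> ball 0 1 \<and> e > 0 \<and>
        (\<forall>g\<in>H_disc. (\<forall>z\<in>K. cmod (g z - f z) < e) \<longrightarrow> g \<in> U))"

definition H_disc_topology :: "(complex \<Rightarrow> complex) topology" where
  "H_disc_topology = topology open_H_disc"

lemma istopology_open_H_disc: "istopology open_H_disc"
  unfolding istopology_def
proof (intro conjI allI impI)
  fix S T assume S: "open_H_disc S" and T: "open_H_disc T"
  show "open_H_disc (S \<inter> T)"
    unfolding open_H_disc_def
  proof (intro conjI ballI)
    show "S \<inter> T \<subseteq> H_disc" using S by (auto simp: open_H_disc_def)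
    fix f assume f: "f \<in> S \<inter> T"
    obtain K d where K: "compact K" "K \<subseteq> ball 0 1" "d > 0"
      "\<forall>g\<in>H_disc. (\<forall>z\<in>K. cmod (g z - f z) < d) \<longrightarrow> g \<in> S"
      using S f unfolding open_H_disc_def by blast
    obtain L e where L: "compact L" "L \<subseteq> ball 0 1" "e > 0"
      "\<forall>g\<in>H_disc. (\<forall>z\<in>L. cmod (g z - f z) < e) \<longrightarrow> g \<in> T"
      using T f unfolding open_H_disc_def by blast
    show "\<exists>K e. compact K \<and> K \<subseteq> ball 0 1 \<and> e > 0 \<and>
        (\<forall>g\<in>H_disc. (\<forall>z\<in>K. cmod (g z - f z) < e) \<longrightarrow> g \<in> S \<inter> T)"
      using K L by (intro exI[of _ "K \<union> L"] exI[of _ "min d e"]) auto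
  qed
next
  fix \<K> assume "\<forall>S\<in>\<K>. open_H_disc S"
  then show "open_H_disc (\<Union>\<K>)"
    unfolding open_H_disc_def
  proof (intro conjI ballI)
    assume *: "\<forall>S\<in>\<K>. S \<subseteq> H_disc \<and> (\<forall>f\<in>S. \<exists>K e. compact K \<and> K \<subseteq> ball 0 1 \<and> e > 0 \<and>
        (\<forall>g\<in>H_disc. (\<forall>z\<in>K. cmod (g z - f z) < e) \<longrightarrow> g \<in> S))"
    then show "\<Union>\<K> \<subseteq> H_disc" by blast
    fix f assume "f \<in> \<Union>\<K>"
    then obtain S where S: "S \<in> \<K>" "f \<in> S" by blast
    obtain K e where "compact K" "K \<subseteq> ball 0 1" "e > 0"
      "\<forall>g\<in>H_disc. (\<forall>z\<in>K. cmod (g z - f z) < e) \<longrightarrow> g \<in> S"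
      using bspec[OF conjunct2[OF bspec[OF * S(1)]] S(2)] by (elim exE conjE)
    then show "\<exists>K e. compact K \<and> K \<subseteq> ball 0 1 \<and> e > 0 \<and>
        (\<forall>g\<in>H_disc. (\<forall>z\<in>K. cmod (g z - f z) < e) \<longrightarrow> g \<in> \<Union>\<K>)"
      using S(1) by (intro exI[of _ K] exI[of _ e]) auto
  qed
qed

lemma openin_H_disc_topology: "openin H_disc_topology U \<longleftrightarrow> open_H_disc U"
  by (simp add: H_disc_topology_def istopology_open_H_disc topology_inverse')

lemma topspace_H_disc_topology: "topspace H_disc_topology = H_disc"
proof -
  have "open_H_disc H_disc"
    unfolding open_H_disc_def by (auto intro!: exI[of _ "{}"] exI[of _ "1::real"])
  then show ?thesis
    unfolding topspace_def openin_H_disc_topology by (auto simp: open_H_disc_def)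
qed

definition seminorm_on :: "(complex \<Rightarrow> complex) set \<Rightarrow> ((complex \<Rightarrow> complex) \<Rightarrow> real) \<Rightarrow> bool" where
  "seminorm_on S p \<longleftrightarrow>
     (\<forall>f\<in>S. 0 \<le> p f) \<and>
     (\<forall>f\<in>S. \<forall>g\<in>S. p (f + g) \<le> p f + p g) \<and>
     (\<forall>c. \<forall>f\<in>S. p (cscale c f) = cmod c * p f)"

definition norm_on :: "(complex \<Rightarrow> complex) set \<Rightarrow> ((complex \<Rightarrow> complex) \<Rightarrow> real) \<Rightarrow> bool" where
  "norm_on S p \<longleftrightarrow> seminorm_on S p \<and> (\<forall>f\<in>S. p f = 0 \<longrightarrow> f = 0)"

definition seminormed_space :: "(complex \<Rightarrow> complex) set \<Rightarrow> ((complex \<Rightarrow> complex) \<Rightarrow> real) \<Rightarrow> bool" where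
  "seminormed_space S p \<longleftrightarrow> cfun.subspace S \<and> seminorm_on S p"

definition normed_space :: "(complex \<Rightarrow> complex) set \<Rightarrow> ((complex \<Rightarrow> complex) \<Rightarrow> real) \<Rightarrow> bool" where
  "normed_space S p \<longleftrightarrow> cfun.subspace S \<and> norm_on S p"

text \<open>The topology on \<open>S\<close> given by the semi-metric \<open>p (g - f)\<close>.\<close>
definition seminorm_topology ::
    "(complex \<Rightarrow> complex) set \<Rightarrow> ((complex \<Rightarrow> complex) \<Rightarrow> real) \<Rightarrow> (complex \<Rightarrow> complex) topology" where
  "seminorm_topology S p =
     topology (\<lambda>U. U \<subseteq> S \<and> (\<forall>f\<in>U. \<exists>e>0. \<forall>g\<in>S. p (g - f) < e \<longrightarrow> g \<in> U))"

lemma openin_seminorm_topology: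
  "openin (seminorm_topology S p) U \<longleftrightarrow>
     U \<subseteq> S \<and> (\<forall>f\<in>U. \<exists>e>0. \<forall>g\<in>S. p (g - f) < e \<longrightarrow> g \<in> U)"
proof -
  let ?P = "\<lambda>U. U \<subseteq> S \<and> (\<forall>f\<in>U. \<exists>e>0. \<forall>g\<in>S. p (g - f) < e \<longrightarrow> g \<in> U)"
  have int: "?P (A \<inter> B)" if A: "?P A" and B: "?P B" for A B
  proof (intro conjI ballI)
    show "A \<inter> B \<subseteq> S" using A by blast
    fix f assume f: "f \<in> A \<inter> B"
    obtain d where d: "d > 0" "\<forall>g\<in>S. p (g - f) < d \<longrightarrow> g \<in> A" using A f by blast
    obtain e where e: "e > 0" "\<forall>g\<in>S. p (g - f) < e \<longrightarrow> g \<in> B" using B f by blast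
    show "\<exists>e>0. \<forall>g\<in>S. p (g - f) < e \<longrightarrow> g \<in> A \<inter> B"
      using d e by (intro exI[of _ "min d e"]) auto
  qed
  have un: "?P (\<Union>\<K>)" if K: "\<forall>A\<in>\<K>. ?P A" for \<K>
  proof (intro conjI ballI)
    show "\<Union>\<K> \<subseteq> S" using K by blast
    fix f assume "f \<in> \<Union>\<K>"
    then obtain A where A: "A \<in> \<K>" "f \<in> A" by blast
    then obtain e where "e > 0" "\<forall>g\<in>S. p (g - f) < e \<longrightarrow> g \<in> A" using K by blast
    then show "\<exists>e>0. \<forall>g\<in>S. p (g - f) < e \<longrightarrow> g \<in> \<Union>\<K>"
      using A(1) by (intro exI[of _ e]) auto
  qed
  have "istopology ?P"
    unfolding istopology_def
    apply (rule conjI)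
     apply (intro allI impI)
     apply (rule int; assumption)
    apply (intro allI impI)
    apply (rule un; assumption)
    done
  then show ?thesis by (simp add: seminorm_topology_def topology_inverse')
qed

lemma topspace_seminorm_topology: "topspace (seminorm_topology S p) = S"
proof -
  have "openin (seminorm_topology S p) S"
    by (auto simp: openin_seminorm_topology intro: exI[of _ "1::real"])
  then have "S \<subseteq> topspace (seminorm_topology S p)"
    by (rule openin_subset)
  moreover have "topspace (seminorm_topology S p) \<subseteq> S"
    unfolding topspace_def openin_seminorm_topology by blast
  ultimately show ?thesis by blast
qed

definition complete_on :: "(complex \<Rightarrow> complex) set \<Rightarrow> ((complex \<Rightarrow> complex) \<Rightarrow> real) \<Rightarrow> bool" where
  "complete_on X N \<longleftrightarrow>
     (\<forall>\<sigma> :: nat \<Rightarrow> complex \<Rightarrow> complex.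
        (\<forall>n. \<sigma> n \<in> X) \<and> (\<forall>e>0. \<exists>k. \<forall>m\<ge>k. \<forall>n\<ge>k. N (\<sigma> m - \<sigma> n) < e) \<longrightarrow>
        (\<exists>f\<in>X. (\<lambda>n. N (\<sigma> n - f)) \<longlonglongrightarrow> 0))"

definition banach_space_analytic ::
    "(complex \<Rightarrow> complex) set \<Rightarrow> ((complex \<Rightarrow> complex) \<Rightarrow> real) \<Rightarrow> bool" where
  "banach_space_analytic X N \<longleftrightarrow>
     X \<subseteq> H_disc \<and> normed_space X N \<and> complete_on X N \<and>
     continuous_map (seminorm_topology X N) H_disc_topology (\<lambda>f. f)"

definition linear_on ::
    "(complex \<Rightarrow> complex) set \<Rightarrow> ((complex \<Rightarrow> complex) \<Rightarrow> (complex \<Rightarrow> complex)) \<Rightarrow> bool" where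
  "linear_on S T \<longleftrightarrow>
     (\<forall>f\<in>S. \<forall>g\<in>S. T (f + g) = T f + T g) \<and>
     (\<forall>c. \<forall>f\<in>S. T (cscale c f) = cscale c (T f))"

text \<open>
  Operators are total functions of which only the values on the relevant subspace matter;
  \<^const>\<open>continuous_map\<close> includes that they map into the target space.
\<close>
definition operator_H_disc :: "((complex \<Rightarrow> complex) \<Rightarrow> (complex \<Rightarrow> complex)) \<Rightarrow> bool" where
  "operator_H_disc T \<longleftrightarrow>
     linear_on H_disc T \<and> continuous_map H_disc_topology H_disc_topology T"

definition bounded_operator_on ::
    "(complex \<Rightarrow> complex) set \<Rightarrow> ((complex \<Rightarrow> complex) \<Rightarrow> real) \<Rightarrow>
     (complex \<Rightarrow> complex) set \<Rightarrow> ((complex \<Rightarrow> complex) \<Rightarrow> real) \<Rightarrow>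
     ((complex \<Rightarrow> complex) \<Rightarrow> (complex \<Rightarrow> complex)) \<Rightarrow> bool" where
  "bounded_operator_on S p R q T \<longleftrightarrow>
     linear_on S T \<and> continuous_map (seminorm_topology S p) (seminorm_topology R q) T"

definition closed_subspace ::
    "(complex \<Rightarrow> complex) set \<Rightarrow> (complex \<Rightarrow> complex) set \<Rightarrow> ((complex \<Rightarrow> complex) \<Rightarrow> real) \<Rightarrow> bool" where
  "closed_subspace Y X p \<longleftrightarrow>
     cfun.subspace Y \<and> Y \<subseteq> X \<and> closedin (seminorm_topology X p) Y"

definition optimal_domain ::
    "((complex \<Rightarrow> complex) \<Rightarrow> (complex \<Rightarrow> complex)) \<Rightarrow> (complex \<Rightarrow> complex) set \<Rightarrow>
     (complex \<Rightarrow> complex) set" where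
  "optimal_domain T X = {f \<in> H_disc. T f \<in> X}"

definition optimal_seminorm ::
    "((complex \<Rightarrow> complex) \<Rightarrow> (complex \<Rightarrow> complex)) \<Rightarrow> ((complex \<Rightarrow> complex) \<Rightarrow> real) \<Rightarrow>
     (complex \<Rightarrow> complex) \<Rightarrow> real" where
  "optimal_seminorm T N f = N (T f)"

definition kernel_on ::
    "(complex \<Rightarrow> complex) set \<Rightarrow> ((complex \<Rightarrow> complex) \<Rightarrow> (complex \<Rightarrow> complex)) \<Rightarrow>
     (complex \<Rightarrow> complex) set" where
  "kernel_on S T = {f \<in> S. T f = 0}"

end

theory Submission
  imports Defs
begin

text \<open>
  The substantial point is that the restriction \<open>T: X \<rightarrow> X\<close> is continuous. If \<open>f\<^sub>n \<rightarrow> f\<close> and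
  \<open>T f\<^sub>n \<rightarrow> g\<close> in \<open>X\<close>, then both limits also hold in the Hausdorff space \<open>H(\<bbbD>)\<close>, where \<open>T\<close> is
  continuous, so \<open>g = T f\<close>; thus the graph of the restriction is closed. The closed graph theorem
  follows from Baire's theorem by successive approximation. For (v), \<open>[T,Y]\<close> is the preimage
  of \<open>Y\<close> under the continuous map \<open>T: [T,X] \<rightarrow> X\<close>.
\<close>

section \<open>Semi-normed function spaces\<close>

context
  fixes S :: "(complex \<Rightarrow> complex) set" and p :: "(complex \<Rightarrow> complex) \<Rightarrow> real"
  assumes S: "seminormed_space S p"
begin

lemma subspace_seminormed_space: "cfun.subspace S"
  using S by (simp add: seminormed_space_def)

lemma seminorm_nonneg: "f \<in> S \<Longrightarrow> 0 \<le> p f"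
  using S by (simp add: seminormed_space_def seminorm_on_def)

lemma seminorm_triangle: "f \<in> S \<Longrightarrow> g \<in> S \<Longrightarrow> p (f + g) \<le> p f + p g"
  using S by (simp add: seminormed_space_def seminorm_on_def)

lemma seminorm_cscale: "f \<in> S \<Longrightarrow> p (cscale c f) = cmod c * p f"
  using S by (simp add: seminormed_space_def seminorm_on_def)

lemma seminorm_zero: "p 0 = 0"
  using seminorm_cscale[of 0 0] subspace_seminormed_space
  by (simp add: cfun.subspace_0)

lemma seminorm_minus: "f \<in> S \<Longrightarrow> p (- f) = p f"
  using seminorm_cscale[of f "-1"] by simp

lemma seminorm_minus_commute: "f \<in> S \<Longrightarrow> g \<in> S \<Longrightarrow> p (f - g) = p (g - f)"
  using seminorm_minus[of "f - g"] subspace_seminormed_space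
  by (simp add: cfun.subspace_diff)

lemma seminorm_diff_le:
  assumes "f \<in> S" "g \<in> S"
  shows "p (f - g) \<le> p f + p g"
  using seminorm_triangle[of f "- g"] seminorm_minus[of g] subspace_seminormed_space assms
  by (simp add: cfun.subspace_neg)

lemma seminorm_triangle_diff:
  assumes "f \<in> S" "g \<in> S" "h \<in> S"
  shows "p (f - h) \<le> p (f - g) + p (g - h)"
  using seminorm_triangle[of "f - g" "g - h"] subspace_seminormed_space assms
  by (simp add: cfun.subspace_diff)

text \<open>Links convergence measured by \<open>p\<close> with the abstract topology: every open
  neighbourhood of \<open>f\<close> contains a \<open>p\<close>-ball about \<open>f\<close> within
  \<open>S\<close>, which catches a tail of the sequence.\<close>

lemma limitin_seminorm_topology:
  assumes "\<And>n. \<sigma> n \<in> S" "f \<in> S" "(\<lambda>n. p (\<sigma> n - f)) \<longlonglongrightarrow> 0"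
  shows "limitin (seminorm_topology S p) \<sigma> f sequentially"
  unfolding limitin_def topspace_seminorm_topology
proof (intro conjI allI impI \<open>f \<in> S\<close>)
  fix U assume "openin (seminorm_topology S p) U \<and> f \<in> U"
  then obtain e where e: "e > 0" "\<forall>g\<in>S. p (g - f) < e \<longrightarrow> g \<in> U"
    unfolding openin_seminorm_topology by blast
  have "\<forall>\<^sub>F n in sequentially. p (\<sigma> n - f) < e"
    using assms(3) e(1) order_tendstoD(2) by blast
  then show "\<forall>\<^sub>F n in sequentially. \<sigma> n \<in> U"
    by (rule eventually_mono) (use e assms in blast)
qed

lemma closedin_seminorm_topology_limit:
  assumes "closedin (seminorm_topology S p) Y"
    and "\<And>n. \<sigma> n \<in> Y" "f \<in> S" "(\<lambda>n. p (\<sigma> n - f)) \<longlonglongrightarrow> 0"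
  shows "f \<in> Y"
proof -
  have "Y \<subseteq> S"
    using closedin_subset[OF assms(1)] by (simp add: topspace_seminorm_topology)
  then have "limitin (seminorm_topology S p) \<sigma> f sequentially"
    using assms by (intro limitin_seminorm_topology) auto
  then show ?thesis
    using assms(1,2) by (auto intro: limitin_closedin)
qed

text \<open>A Cauchy sequence in \<open>Y\<close> has a limit in \<open>S\<close>, and closedness
  brings that limit back into \<open>Y\<close>.\<close>

lemma complete_on_closed_subspace:
  assumes "closed_subspace Y S p" "complete_on S p"
  shows "complete_on Y p"
  unfolding complete_on_def
proof (intro allI impI)
  fix \<sigma> :: "nat \<Rightarrow> complex \<Rightarrow> complex"
  assume \<sigma>: "(\<forall>n. \<sigma> n \<in> Y) \<and> (\<forall>e>0. \<exists>k. \<forall>m\<ge>k. \<forall>n\<ge>k. p (\<sigma> m - \<sigma> n) < e)"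
  have "Y \<subseteq> S" and closed: "closedin (seminorm_topology S p) Y"
    using assms(1) by (auto simp: closed_subspace_def)
  obtain f where "f \<in> S" "(\<lambda>n. p (\<sigma> n - f)) \<longlonglongrightarrow> 0"
    using assms(2)[unfolded complete_on_def, rule_format, of \<sigma>] \<sigma> \<open>Y \<subseteq> S\<close> by blast
  then show "\<exists>f\<in>Y. (\<lambda>n. p (\<sigma> n - f)) \<longlonglongrightarrow> 0"
    using closedin_seminorm_topology_limit[OF closed] \<sigma> by blast
qed

end

text \<open>Lets the continuous inclusion of \<open>X\<close> into H(D) be passed on to a subspace
  \<open>Y\<close> by composition.\<close>

lemma continuous_map_seminorm_subset:
  assumes "Y \<subseteq> X"
  shows "continuous_map (seminorm_topology Y p) (seminorm_topology X p) (\<lambda>f. f)"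
  unfolding continuous_map_def topspace_seminorm_topology
proof (intro conjI allI impI)
  show "(\<lambda>f. f) \<in> Y \<rightarrow> X" using assms by blast
  fix U assume U: "openin (seminorm_topology X p) U"
  show "openin (seminorm_topology Y p) {f \<in> Y. f \<in> U}"
    unfolding openin_seminorm_topology
  proof (intro conjI ballI)
    fix f assume "f \<in> {f \<in> Y. f \<in> U}"
    then obtain e where "e > 0" "\<forall>g\<in>X. p (g - f) < e \<longrightarrow> g \<in> U"
      using U unfolding openin_seminorm_topology by blast
    then show "\<exists>e>0. \<forall>g\<in>Y. p (g - f) < e \<longrightarrow> g \<in> {f \<in> Y. f \<in> U}"
      using assms by (intro exI[of _ e]) auto
  qed auto
qed

lemma norm_on_subset: "norm_on S p \<Longrightarrow> R \<subseteq> S \<Longrightarrow> norm_on R p"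
  by (simp add: norm_on_def seminorm_on_def subset_iff)

lemma closed_subspace_banach_space_analytic:
  assumes "banach_space_analytic X N" "closed_subspace Y X N"
  shows "banach_space_analytic Y N"
proof -
  have X: "X \<subseteq> H_disc" "normed_space X N" "complete_on X N"
    and cont: "continuous_map (seminorm_topology X N) H_disc_topology (\<lambda>f. f)"
    using assms(1) by (auto simp: banach_space_analytic_def)
  have Y: "cfun.subspace Y" "Y \<subseteq> X"
    using assms(2) by (auto simp: closed_subspace_def)
  have "seminormed_space X N"
    using X(2) by (simp add: seminormed_space_def normed_space_def norm_on_def)
  then have "complete_on Y N"
    using complete_on_closed_subspace assms(2) X(3) by blast
  moreover have "normed_space Y N"
    using X(2) Y by (auto simp: normed_space_def intro: norm_on_subset)
  moreover have "continuous_map (seminorm_topology Y N) H_disc_topology (\<lambda>f. f)"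
    using continuous_map_compose[OF continuous_map_seminorm_subset[OF Y(2)] cont]
    by (simp add: o_def)
  ultimately show ?thesis
    using X Y unfolding banach_space_analytic_def by blast
qed

section \<open>Linear maps\<close>

lemma linear_on_subset: "linear_on S T \<Longrightarrow> R \<subseteq> S \<Longrightarrow> linear_on R T"
  unfolding linear_on_def by blast

context
  fixes S :: "(complex \<Rightarrow> complex) set" and T :: "(complex \<Rightarrow> complex) \<Rightarrow> complex \<Rightarrow> complex"
  assumes S: "cfun.subspace S" and T: "linear_on S T"
begin

lemma linear_on_zero: "T 0 = 0"
proof -
  have "T (cscale 0 0) = cscale 0 (T 0)"
    using T cfun.subspace_0[OF S] unfolding linear_on_def by blast
  then show ?thesis by simp
qed

lemma linear_on_diff:
  assumes "f \<in> S" "g \<in> S"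
  shows "T (f - g) = T f - T g"
proof -
  have "T (f - g) + T g = T (f - g + g)"
    using T cfun.subspace_diff[OF S] assms unfolding linear_on_def by metis
  then show ?thesis by (simp add: algebra_simps)
qed

lemma linear_on_injD:
  assumes "inj_on T S" "f \<in> S" "T f = 0"
  shows "f = 0"
  using assms linear_on_zero cfun.subspace_0[OF S] by (metis inj_onD)

lemma subspace_vimage_linear_on:
  assumes "cfun.subspace R"
  shows "cfun.subspace {f \<in> S. T f \<in> R}"
  using assms S T linear_on_zero by (auto simp: cfun.subspace_def linear_on_def)

end

text \<open>Linearity turns the estimate at 0 into one at every point, through
  \<open>T g - T f = T (g - f)\<close>. It serves for the restriction of \<open>T\<close> to
  \<open>X\<close>, for the inclusion of \<open>X\<close> into [T,X], and for \<open>T\<close> on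
  [T,X].\<close>

lemma continuous_map_seminorm_bounded:
  assumes S: "seminormed_space S p"
    and T: "linear_on S T" "T ` S \<subseteq> R"
    and bound: "\<And>f. f \<in> S \<Longrightarrow> q (T f) \<le> C * p f"
  shows "continuous_map (seminorm_topology S p) (seminorm_topology R q) T"
  unfolding continuous_map_def topspace_seminorm_topology
proof (intro conjI allI impI)
  note sub = subspace_seminormed_space[OF S]
  show "T \<in> S \<rightarrow> R" using T(2) by blast
  fix U assume U: "openin (seminorm_topology R q) U"
  show "openin (seminorm_topology S p) {f \<in> S. T f \<in> U}"
    unfolding openin_seminorm_topology
  proof (intro conjI ballI)
    fix f assume f: "f \<in> {f \<in> S. T f \<in> U}"
    then obtain e where e: "e > 0" "\<forall>g\<in>R. q (g - T f) < e \<longrightarrow> g \<in> U"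
      using U unfolding openin_seminorm_topology by blast
    \<comment> \<open>Nothing is assumed about the sign of \<open>C\<close>; the denominator
      \<open>\<bar>C\<bar> + 1\<close> is positive and dominates \<open>C\<close>.\<close>
    have "T g \<in> U" if g: "g \<in> S" "p (g - f) < e / (\<bar>C\<bar> + 1)" for g
    proof -
      have gf: "g - f \<in> S" using f g sub by (simp add: cfun.subspace_diff)
      have "q (T g - T f) = q (T (g - f))"
        using linear_on_diff[OF sub T(1)] f g by simp
      also have "\<dots> \<le> C * p (g - f)" by (rule bound[OF gf])
      also have "\<dots> \<le> (\<bar>C\<bar> + 1) * p (g - f)"
        using seminorm_nonneg[OF S gf] by (intro mult_right_mono) auto
      also have "\<dots> < e"
        using g(2) by (simp add: field_simps)
      finally show ?thesis using e(2) T(2) g(1) by blast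
    qed
    then show "\<exists>e>0. \<forall>g\<in>S. p (g - f) < e \<longrightarrow> g \<in> {f \<in> S. T f \<in> U}"
      using e(1) by (intro exI[of _ "e / (\<bar>C\<bar> + 1)"]) auto
  qed auto
qed

section \<open>The closed graph theorem\<close>

context
  fixes X :: "(complex \<Rightarrow> complex) set" and N :: "(complex \<Rightarrow> complex) \<Rightarrow> real"
  assumes normed: "normed_space X N"
begin

lemma normed_space_imp_seminormed_space: "seminormed_space X N"
  using normed by (simp add: seminormed_space_def normed_space_def norm_on_def)

lemma norm_eq_0_iff: "f \<in> X \<Longrightarrow> N f = 0 \<longleftrightarrow> f = 0"
  using normed seminorm_zero[OF normed_space_imp_seminormed_space]
  by (auto simp: normed_space_def norm_on_def)

text \<open>The cut-off outside \<open>X\<close> is needed because \<^locale>\<open>Metric_space\<close> demands a symmetric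
  nonnegative distance on the whole type.\<close>
definition norm_dist :: "(complex \<Rightarrow> complex) \<Rightarrow> (complex \<Rightarrow> complex) \<Rightarrow> real" where
  "norm_dist f g = (if f \<in> X \<and> g \<in> X then N (f - g) else 0)"

lemma Metric_space_norm_dist: "Metric_space X norm_dist"
proof -
  note sn = normed_space_imp_seminormed_space
  note diff = cfun.subspace_diff[OF subspace_seminormed_space[OF sn]]
  show ?thesis
    by unfold_locales
      (auto simp: norm_dist_def seminorm_nonneg[OF sn] seminorm_minus_commute[OF sn]
        norm_eq_0_iff diff intro: seminorm_triangle_diff[OF sn])
qed

interpretation Metric_space X norm_dist
  by (rule Metric_space_norm_dist)

text \<open>Gives access to Baire's theorem for metric spaces. The cut-off in
  \<open>norm_dist\<close> is harmless, since the sequence and its limit stay in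
  \<open>X\<close>.\<close>

lemma mcomplete_norm_dist:
  assumes "complete_on X N"
  shows "mcomplete"
  unfolding mcomplete_def
proof (intro allI impI)
  fix \<sigma> assume \<sigma>: "MCauchy \<sigma>"
  then have mem: "\<sigma> n \<in> X" for n
    unfolding MCauchy_def by blast
  have "\<exists>k. \<forall>m\<ge>k. \<forall>n\<ge>k. N (\<sigma> m - \<sigma> n) < e" if e: "e > 0" for e
  proof -
    obtain k where "\<forall>m n. k \<le> m \<longrightarrow> k \<le> n \<longrightarrow> norm_dist (\<sigma> m) (\<sigma> n) < e"
      using \<sigma> e unfolding MCauchy_def by blast
    then show ?thesis using mem by (auto simp: norm_dist_def)
  qed
  then obtain f where f: "f \<in> X" "(\<lambda>n. N (\<sigma> n - f)) \<longlonglongrightarrow> 0"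
    using assms[unfolded complete_on_def, rule_format, of \<sigma>] mem by blast
  have "\<exists>k. \<forall>n\<ge>k. \<sigma> n \<in> X \<and> norm_dist (\<sigma> n) f < e" if "e > 0" for e
  proof -
    have "\<forall>\<^sub>F n in sequentially. N (\<sigma> n - f) < e"
      using f(2) that order_tendstoD(2) by blast
    then show ?thesis
      using mem f(1) by (auto simp: norm_dist_def eventually_sequentially)
  qed
  then show "\<exists>f. limitin mtopology \<sigma> f sequentially"
    using f(1) by (auto simp: limit_metric_sequentially)
qed

text \<open>One of the sublevel sets \<open>{q (T f) \<le> n}\<close> is dense in some ball; the difference of two
  points of that set approximates the difference of two points of the ball, and homogeneity
  turns this into a uniform statement.\<close>
lemma linear_approximation:
  assumes compl: "complete_on X N" and q: "seminormed_space R q"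
    and T: "linear_on X T" "T ` X \<subseteq> R"
  obtains K where "K \<ge> 0"
    and "\<And>h. h \<in> X \<Longrightarrow> \<exists>u\<in>X. q (T u) \<le> K * N h \<and> N (h - u) \<le> N h / 2"
proof -
  note sn = normed_space_imp_seminormed_space
  note sub = subspace_seminormed_space[OF sn]
  note mem = cfun.subspace_diff[OF sub] cfun.subspace_add[OF sub] cfun.subspace_scale[OF sub]
  define A where "A n = {f \<in> X. q (T f) \<le> real n}" for n :: nat
  \<comment> \<open>By Baire, if all these closures had empty interior, so would their union. But
    the sets \<open>A n\<close> cover \<open>X\<close>, because \<open>q (T f)\<close> is a finite
    real, and \<open>X\<close> is its own interior and contains 0.\<close>
  have "\<exists>n. mtopology interior_of (mtopology closure_of A n) \<noteq> {}"
  proof (rule ccontr)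
    assume "\<not> ?thesis"
    then have "mtopology interior_of \<Union>(range (\<lambda>n. mtopology closure_of A n)) = {}"
      using mcomplete_norm_dist[OF compl] by (intro metric_Baire_category_alt) auto
    moreover have "\<Union>(range (\<lambda>n. mtopology closure_of A n)) = X"
    proof (intro equalityI subsetI)
      fix f assume f: "f \<in> X"
      obtain n :: nat where "q (T f) \<le> real n" using real_arch_simple by blast
      then have "f \<in> mtopology closure_of A n"
        using f closure_of_subset[of "A n" mtopology] by (auto simp: A_def)
      then show "f \<in> \<Union>(range (\<lambda>n. mtopology closure_of A n))" by blast
    qed (use closure_of_subset_topspace[of mtopology] in auto)
    ultimately show False
      using cfun.subspace_0[OF sub] interior_of_topspace[of mtopology] by auto
  qed
  then obtain n f0 where "f0 \<in> mtopology interior_of (mtopology closure_of A n)"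
    by blast
  then obtain r where f0: "f0 \<in> X" and r: "r > 0" "mball f0 r \<subseteq> mtopology closure_of A n"
    unfolding in_interior_of_mball by blast
  have approx: "\<exists>a\<in>A n. N (f - a) < e" if f: "f \<in> X" "N (f0 - f) < r" and e: "e > 0" for f e
  proof -
    have "f \<in> mtopology closure_of A n"
      using f f0 r by (auto simp: norm_dist_def subset_iff)
    then obtain a where "a \<in> A n" "a \<in> mball f e"
      using e unfolding metric_closure_of by blast
    then show ?thesis
      by (auto simp: norm_dist_def A_def)
  qed
  \<comment> \<open>Both \<open>f0 + h\<close> and \<open>f0\<close> lie in the ball; approximating
    each to within \<open>e / 2\<close> by points of \<open>A n\<close> gives
    \<open>u = a - b\<close>. The bound \<open>2 * real n\<close> is independent of
    \<open>e\<close>.\<close>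
  have small: "\<exists>u\<in>X. q (T u) \<le> 2 * real n \<and> N (h - u) < e"
    if h: "h \<in> X" "N h < r" "e > 0" for h e
  proof -
    have "N (f0 - (f0 + h)) = N h"
      using seminorm_minus[OF sn h(1)] by simp
    then obtain a where a: "a \<in> A n" "N (f0 + h - a) < e / 2"
      using approx[of "f0 + h" "e / 2"] f0 h by (auto simp: mem)
    obtain b where b: "b \<in> A n" "N (f0 - b) < e / 2"
      using approx[of f0 "e / 2"] f0 h r seminorm_zero[OF sn] by auto
    have abX: "a \<in> X" "b \<in> X" using a b by (auto simp: A_def)
    have "q (T (a - b)) = q (T a - T b)"
      using linear_on_diff[OF sub T(1)] abX by simp
    also have "\<dots> \<le> q (T a) + q (T b)"
      using abX T(2) by (intro seminorm_diff_le[OF q]) auto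
    also have "\<dots> \<le> 2 * real n" using a b by (auto simp: A_def)
    finally have 1: "q (T (a - b)) \<le> 2 * real n" .
    have "N (h - (a - b)) = N ((f0 + h - a) - (f0 - b))"
      by (rule arg_cong[where f = N]) (simp add: fun_eq_iff)
    also have "\<dots> \<le> N (f0 + h - a) + N (f0 - b)"
      by (intro seminorm_diff_le[OF sn] mem abX f0 h)
    also have "\<dots> < e" using a(2) b(2) by linarith
    finally show ?thesis using 1 mem(1)[OF abX] by blast
  qed
  have "\<exists>u\<in>X. q (T u) \<le> 4 * real n / r * N h \<and> N (h - u) \<le> N h / 2" if h: "h \<in> X" for h
  proof (cases "h = 0")
    case True
    then show ?thesis
      using linear_on_zero[OF sub T(1)] seminorm_zero[OF q] seminorm_zero[OF sn] h
      by (intro bexI[of _ 0]) auto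
  next
    case False
    then have Nh: "N h > 0"
      using h norm_eq_0_iff seminorm_nonneg[OF sn h] by fastforce
    \<comment> \<open>The factor scales \<open>h\<close> to norm \<open>r / 2\<close>, inside the
      range of \<open>small\<close>. The tolerance \<open>t * (N h / 2)\<close> becomes
      \<open>N h / 2\<close> after dividing by \<open>t\<close>, and \<open>2 * real n / t\<close>
      is \<open>4 * real n / r * N h\<close>.\<close>
    define t where "t = r / (2 * N h)"
    have t: "t > 0" using Nh r by (simp add: t_def)
    have "N (cscale t h) = t * N h"
      using seminorm_cscale[OF sn h, of t] t by simp
    then have "N (cscale t h) = r / 2"
      using Nh by (simp add: t_def)
    then obtain u where u: "u \<in> X" "q (T u) \<le> 2 * real n" "N (cscale t h - u) < t * (N h / 2)"
      using small[of "cscale t h" "t * (N h / 2)"] h r t Nh by (auto simp: mem)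
    define v where "v = cscale (1 / t) u"
    have v: "v \<in> X" using u by (simp add: v_def mem)
    have "q (T v) = q (cscale (1 / t) (T u))"
      using T(1) u by (simp add: v_def linear_on_def)
    also have "\<dots> = q (T u) / t"
      using seminorm_cscale[OF q, of "T u"] T(2) u t by (auto simp: norm_divide)
    also have "\<dots> \<le> 2 * real n / t" using u t by (simp add: divide_right_mono)
    also have "\<dots> = 4 * real n / r * N h" by (simp add: t_def)
    finally have 1: "q (T v) \<le> 4 * real n / r * N h" .
    have "cscale t h - u = cscale t (h - v)"
      using t by (simp add: v_def cfun.scale_right_diff_distrib)
    then have "t * N (h - v) < t * (N h / 2)"
      using u(3) seminorm_cscale[OF sn, of "h - v" t] h v t by (simp add: mem)
    then have "N (h - v) \<le> N h / 2" using t by simp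
    with 1 v show ?thesis by blast
  qed
  then show thesis using that[of "4 * real n / r"] r by auto
qed

text \<open>Subtracting approximants repeatedly leaves remainders of \<open>h\<close> that tend to 0
  geometrically, while their images form a Cauchy sequence. The closed graph forces the limit of the
  images to be 0, so the geometric bound on the corrections bounds \<open>T h\<close>
  itself.\<close>

theorem closed_graph:
  assumes compl: "complete_on X N" and q: "seminormed_space R q" "complete_on R q"
    and T: "linear_on X T" "T ` X \<subseteq> R"
    and closed: "\<And>\<sigma> f g. (\<And>n. \<sigma> n \<in> X) \<Longrightarrow> f \<in> X \<Longrightarrow> g \<in> R \<Longrightarrow> (\<lambda>n. N (\<sigma> n - f)) \<longlonglongrightarrow> 0
      \<Longrightarrow> (\<lambda>n. q (T (\<sigma> n) - g)) \<longlonglongrightarrow> 0 \<Longrightarrow> T f = g"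
  obtains C where "\<And>f. f \<in> X \<Longrightarrow> q (T f) \<le> C * N f"
proof -
  note sn = normed_space_imp_seminormed_space
  note sub = subspace_seminormed_space[OF sn] and subR = subspace_seminormed_space[OF q(1)]
  note mem = cfun.subspace_diff[OF sub] cfun.subspace_diff[OF subR]
  note diffT = linear_on_diff[OF sub T(1)]
  obtain K where K: "K \<ge> 0"
    and "\<And>h. h \<in> X \<Longrightarrow> \<exists>u\<in>X. q (T u) \<le> K * N h \<and> N (h - u) \<le> N h / 2"
    using linear_approximation[OF compl q(1) T] by blast
  then obtain U where U: "\<And>h. h \<in> X \<Longrightarrow> U h \<in> X" "\<And>h. h \<in> X \<Longrightarrow> q (T (U h)) \<le> K * N h"
    "\<And>h. h \<in> X \<Longrightarrow> N (h - U h) \<le> N h / 2"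
    by metis
  have "q (T h) \<le> 2 * K * N h" if h: "h \<in> X" for h
  proof -
    \<comment> \<open>\<open>w n\<close> is what remains of \<open>h\<close> after \<open>n\<close>
      corrections; each correction at least halves the bound on its norm.\<close>
    define w where "w n = ((\<lambda>f. f - U f) ^^ n) h" for n
    have w_Suc: "w (Suc n) = w n - U (w n)" and w0: "w 0 = h" for n
      by (simp_all add: w_def)
    have wX: "w n \<in> X" for n
      by (induction n) (simp_all only: w0 w_Suc h mem U)
    have TwR: "T (w n) \<in> R" for n using wX T(2) by blast
    have Nw: "N (w n) \<le> N h / 2 ^ n" for n
    proof (induction n)
      case (Suc n)
      have "N (w (Suc n)) \<le> N (w n) / 2" using U(3) wX by (simp add: w_Suc)
      also have "\<dots> \<le> N h / 2 ^ n / 2" using Suc by (rule divide_right_mono) simp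
      finally show ?case by (simp add: field_simps)
    qed (simp add: w0)
    have step: "q (T (w n) - T (w (Suc n))) \<le> K * (N h / 2 ^ n)" for n
    proof -
      have "T (w n) - T (w (Suc n)) = T (U (w n))"
        using diffT[of "w n" "U (w n)"] wX U(1) by (simp add: w_Suc)
      then show ?thesis
        using order_trans[OF U(2)[OF wX] mult_left_mono[OF Nw K]] by simp
    qed
    \<comment> \<open>The right-hand side is the sum of \<open>K * (N h / 2 ^ k)\<close> for
      \<open>k\<close> from \<open>n\<close> to \<open>n + m - 1\<close>. Keeping the subtracted
      term makes the induction on \<open>m\<close> close exactly.\<close>
    have tail: "q (T (w n) - T (w (n + m))) \<le> 2 * K * N h * (1 / 2 ^ n - 1 / 2 ^ (n + m))" for n m
    proof (induction m)
      case 0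
      show ?case using seminorm_zero[OF q(1)] by (simp only: add_0_right diff_self)
    next
      case (Suc m)
      have "q (T (w n) - T (w (n + Suc m)))
          \<le> q (T (w n) - T (w (n + m))) + q (T (w (n + m)) - T (w (n + Suc m)))"
        by (rule seminorm_triangle_diff[OF q(1) TwR TwR TwR])
      also have "\<dots> \<le> 2 * K * N h * (1 / 2 ^ n - 1 / 2 ^ (n + m)) + K * (N h / 2 ^ (n + m))"
        by (rule add_mono[OF Suc]) (use step[of "n + m"] in simp)
      also have "\<dots> = 2 * K * N h * (1 / 2 ^ n - 1 / 2 ^ (n + Suc m))"
        by (simp add: field_simps)
      finally show ?case .
    qed
    define B where "B = 2 * K * N h"
    have B: "B \<ge> 0" using K seminorm_nonneg[OF sn h] by (simp add: B_def)
    have tail': "q (T (w n) - T (w m)) \<le> B / 2 ^ n" if "n \<le> m" for n m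
    proof -
      have "q (T (w n) - T (w m)) \<le> B * (1 / 2 ^ n - 1 / 2 ^ m)"
        using tail[of n "m - n"] that by (simp add: B_def)
      also have "\<dots> \<le> B * (1 / 2 ^ n)" using B by (intro mult_left_mono) auto
      finally show ?thesis by simp
    qed
    have "(\<lambda>k. B * (1 / 2) ^ k) \<longlonglongrightarrow> B * 0"
      by (intro tendsto_intros LIMSEQ_power_zero) auto
    then have lim0: "(\<lambda>k. B / 2 ^ k) \<longlonglongrightarrow> 0"
      by (simp add: power_divide)
    have cauchy: "\<exists>k. \<forall>m\<ge>k. \<forall>n\<ge>k. q (T (w m) - T (w n)) < e" if e: "e > 0" for e
    proof -
      obtain k where k: "\<And>n. n \<ge> k \<Longrightarrow> B / 2 ^ n < e"
        using order_tendstoD(2)[OF lim0 e] unfolding eventually_sequentially by blast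
      have "q (T (w m) - T (w n)) < e" if "m \<ge> k" "n \<ge> k" for m n
        using tail'[of m n] tail'[of n m] k[OF that(1)] k[OF that(2)]
          seminorm_minus_commute[OF q(1) TwR TwR, of m n] by (cases "m \<le> n") auto
      then show ?thesis by blast
    qed
    obtain g where g: "g \<in> R" "(\<lambda>n. q (T (w n) - g)) \<longlonglongrightarrow> 0"
      using q(2)[unfolded complete_on_def, rule_format, of "\<lambda>n. T (w n)"] TwR cauchy by blast
    have "(\<lambda>n. N h * (1 / 2) ^ n) \<longlonglongrightarrow> N h * 0"
      by (intro tendsto_intros LIMSEQ_power_zero) auto
    then have "(\<lambda>n. N h / 2 ^ n) \<longlonglongrightarrow> 0"
      by (simp add: power_divide)
    then have "(\<lambda>n. N (w n)) \<longlonglongrightarrow> 0"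
      by (rule Lim_null_comparison[rotated])
        (simp add: Nw seminorm_nonneg[OF sn wX])
    then have "(\<lambda>n. N (w n - 0)) \<longlonglongrightarrow> 0"
      by (simp only: diff_zero)
    \<comment> \<open>The graph hypothesis is applied to the remainders: \<open>w n\<close> tends to
      0 and \<open>T (w n)\<close> to \<open>g\<close>. Hence \<open>g = T 0 = 0\<close>, and the
      images of the remainders vanish in the limit.\<close>
    then have "T 0 = g"
      by (rule closed[OF wX cfun.subspace_0[OF sub] g(1) _ g(2)])
    then have lim: "(\<lambda>n. q (T (w n))) \<longlonglongrightarrow> 0"
      using g linear_on_zero[OF sub T(1)] by simp
    \<comment> \<open>The corrections made up to stage \<open>n\<close> contribute at most
      \<open>B\<close>, uniformly in \<open>n\<close>; the remaining term disappears as
      \<open>n\<close> grows.\<close>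
    have "q (T h) \<le> B + q (T (w n))" for n
    proof -
      have "q (T h) = q ((T (w 0) - T (w n)) + T (w n))" by (simp add: w0)
      also have "\<dots> \<le> q (T (w 0) - T (w n)) + q (T (w n))"
        by (intro seminorm_triangle[OF q(1)] mem TwR)
      also have "\<dots> \<le> B + q (T (w n))" using tail'[of 0 n] by simp
      finally show ?thesis .
    qed
    moreover have "(\<lambda>n. B + q (T (w n))) \<longlonglongrightarrow> B + 0"
      by (intro tendsto_intros lim)
    ultimately have "q (T h) \<le> B + 0"
      by (intro LIMSEQ_le_const) auto
    then show ?thesis by (simp add: B_def)
  qed
  then show thesis using that by blast
qed

end

section \<open>Operators on the space of analytic functions\<close>

text \<open>A single point of the disc is a compact set, so evaluation at \<open>z\<close> is
  continuous for the topology of H(D).\<close>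

lemma limitin_H_disc_pointwise:
  assumes "limitin H_disc_topology \<sigma> f sequentially" "z \<in> ball 0 1"
  shows "(\<lambda>n. \<sigma> n z) \<longlonglongrightarrow> f z"
proof (rule tendstoI)
  fix e :: real assume e: "e > 0"
  define U where "U = {g \<in> H_disc. cmod (g z - f z) < e}"
  have "open_H_disc U"
    unfolding open_H_disc_def
  proof (intro conjI ballI)
    fix g assume g: "g \<in> U"
    \<comment> \<open>The radius is the slack left at \<open>g\<close>; the triangle inequality at
      \<open>z\<close> then keeps \<open>h\<close> within \<open>e\<close> of
      \<open>f\<close>.\<close>
    have "h \<in> U" if "h \<in> H_disc" "cmod (h z - g z) < e - cmod (g z - f z)" for h
      using that norm_triangle_ineq[of "h z - g z" "g z - f z"] by (simp add: U_def)
    then show "\<exists>K d. compact K \<and> K \<subseteq> ball 0 1 \<and> d > 0 \<and>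
        (\<forall>h\<in>H_disc. (\<forall>w\<in>K. cmod (h w - g w) < d) \<longrightarrow> h \<in> U)"
      using g assms(2)
      by (intro exI[of _ "{z}"] exI[of _ "e - cmod (g z - f z)"]) (auto simp: U_def)
  qed (auto simp: U_def)
  then have "\<forall>\<^sub>F n in sequentially. \<sigma> n \<in> U"
    using assms(1) e unfolding limitin_def topspace_H_disc_topology openin_H_disc_topology
    by (auto simp: U_def)
  then show "\<forall>\<^sub>F n in sequentially. dist (\<sigma> n z) (f z) < e"
    by (rule eventually_mono) (simp add: U_def dist_norm)
qed

text \<open>Inside the disc, pointwise limits are unique; outside it both functions are zero by the
  convention of \<open>H_disc\<close>.\<close>

lemma limitin_H_disc_unique:
  assumes "limitin H_disc_topology \<sigma> f sequentially" "limitin H_disc_topology \<sigma> g sequentially"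
  shows "f = g"
proof
  fix z
  have "f \<in> H_disc" "g \<in> H_disc"
    using assms by (auto simp: limitin_def topspace_H_disc_topology)
  then show "f z = g z"
    using limitin_H_disc_pointwise[OF assms(1), of z] limitin_H_disc_pointwise[OF assms(2), of z]
      LIMSEQ_unique by (cases "z \<in> ball 0 1") (auto simp: H_disc_def)
qed

lemma banach_space_analytic_limitin:
  assumes X: "banach_space_analytic X N"
    and "\<And>n. \<sigma> n \<in> X" "f \<in> X" "(\<lambda>n. N (\<sigma> n - f)) \<longlonglongrightarrow> 0"
  shows "limitin H_disc_topology \<sigma> f sequentially"
proof -
  have "seminormed_space X N"
    and "continuous_map (seminorm_topology X N) H_disc_topology (\<lambda>f. f)"
    using X by (auto simp: banach_space_analytic_def normed_space_imp_seminormed_space)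
  from continuous_map_limit[OF this(2) limitin_seminorm_topology[OF this(1) assms(2-4)]]
  show ?thesis by (simp add: o_def)
qed

text \<open>The closed graph theorem is applied with \<open>X\<close> as source and target, and the
  two candidate limits of the images are compared in the weaker topology of H(D). The constant
  \<open>C\<close> later controls both the restriction of \<open>T\<close> and the inclusion of
  \<open>X\<close> into [T,X].\<close>

lemma operator_H_disc_bounded:
  assumes X: "banach_space_analytic X N" and T: "operator_H_disc T" "T ` X \<subseteq> X"
  obtains C where "\<And>f. f \<in> X \<Longrightarrow> N (T f) \<le> C * N f"
proof -
  have XH: "X \<subseteq> H_disc" and n: "normed_space X N" and c: "complete_on X N"
    using X by (auto simp: banach_space_analytic_def)
  have lin: "linear_on H_disc T" and cont: "continuous_map H_disc_topology H_disc_topology T"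
    using T(1) by (auto simp: operator_H_disc_def)
  show thesis
  proof (rule closed_graph[OF n c normed_space_imp_seminormed_space[OF n] c
        linear_on_subset[OF lin XH] T(2)])
    fix \<sigma> f g
    assume \<sigma>: "\<And>n. \<sigma> n \<in> X" and fg: "f \<in> X" "g \<in> X" and f: "(\<lambda>n. N (\<sigma> n - f)) \<longlonglongrightarrow> 0"
      and g: "(\<lambda>n. N (T (\<sigma> n) - g)) \<longlonglongrightarrow> 0"
    have "limitin H_disc_topology (T \<circ> \<sigma>) (T f) sequentially"
      using banach_space_analytic_limitin[OF X \<sigma> fg(1) f] by (rule continuous_map_limit[OF cont])
    moreover have "limitin H_disc_topology (T \<circ> \<sigma>) g sequentially"
      using T(2) \<sigma> fg(2) g by (intro banach_space_analytic_limitin[OF X]) auto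
    ultimately show "T f = g" by (rule limitin_H_disc_unique)
  qed (use that in blast)
qed

section \<open>Optimal domains\<close>

lemma subspace_optimal_domain:
  assumes "linear_on H_disc T" "cfun.subspace Y"
  shows "cfun.subspace (optimal_domain T Y)"
  unfolding optimal_domain_def by (rule subspace_vimage_linear_on[OF subspace_H_disc assms])

lemma seminormed_space_optimal_domain:
  assumes "linear_on H_disc T" "seminormed_space X N"
  shows "seminormed_space (optimal_domain T X) (optimal_seminorm T N)"
  unfolding seminormed_space_def seminorm_on_def optimal_seminorm_def
proof (intro conjI ballI allI)
  show "cfun.subspace (optimal_domain T X)"
    using subspace_optimal_domain[OF assms(1) subspace_seminormed_space[OF assms(2)]] .
  fix f assume f: "f \<in> optimal_domain T X"
  then have Tf: "f \<in> H_disc" "T f \<in> X" by (auto simp: optimal_domain_def)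
  show "0 \<le> N (T f)" by (rule seminorm_nonneg[OF assms(2) Tf(2)])
  show "N (T (cscale c f)) = cmod c * N (T f)" for c
    using assms(1) Tf(1) seminorm_cscale[OF assms(2) Tf(2)] by (simp add: linear_on_def)
  fix g assume "g \<in> optimal_domain T X"
  then have Tg: "g \<in> H_disc" "T g \<in> X" by (auto simp: optimal_domain_def)
  have "T (f + g) = T f + T g"
    using assms(1) Tf(1) Tg(1) unfolding linear_on_def by blast
  then show "N (T (f + g)) \<le> N (T f) + N (T g)"
    using seminorm_triangle[OF assms(2) Tf(2) Tg(2)] by simp
qed

text \<open>Definiteness takes two steps: \<open>N (T f) = 0\<close> gives \<open>T f = 0\<close>
  because \<open>N\<close> is a norm, and injectivity then gives \<open>f = 0\<close>.\<close>

lemma normed_space_optimal_domain: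
  assumes "linear_on H_disc T" "normed_space X N" "inj_on T H_disc"
  shows "normed_space (optimal_domain T X) (optimal_seminorm T N)"
proof -
  have "f = 0" if "f \<in> optimal_domain T X" "optimal_seminorm T N f = 0" for f
    using that norm_eq_0_iff[OF assms(2)] linear_on_injD[OF subspace_H_disc assms(1,3)]
    by (auto simp: optimal_domain_def optimal_seminorm_def)
  then show ?thesis
    using seminormed_space_optimal_domain[OF assms(1) normed_space_imp_seminormed_space[OF assms(2)]]
    by (auto simp: normed_space_def norm_on_def seminormed_space_def)
qed

text \<open>The seminorm of \<open>f\<close> in [T,X] is by definition \<open>N (T f)\<close>, so
  \<open>T\<close> preserves seminorms and the constant 1 suffices.\<close>

lemma bounded_operator_on_optimal_domain:
  assumes "linear_on H_disc T" "seminormed_space X N"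
  shows "bounded_operator_on (optimal_domain T X) (optimal_seminorm T N) X N T"
  unfolding bounded_operator_on_def
proof
  show lin: "linear_on (optimal_domain T X) T"
    using assms(1) by (rule linear_on_subset) (auto simp: optimal_domain_def)
  show "continuous_map (seminorm_topology (optimal_domain T X) (optimal_seminorm T N))
      (seminorm_topology X N) T"
    by (rule continuous_map_seminorm_bounded[where C = 1,
          OF seminormed_space_optimal_domain[OF assms] lin])
      (auto simp: optimal_domain_def optimal_seminorm_def)
qed

lemma closed_subspace_optimal_domain:
  assumes "linear_on H_disc T" "seminormed_space X N" "closed_subspace Y X N"
  shows "closed_subspace (optimal_domain T Y) (optimal_domain T X) (optimal_seminorm T N)"
proof -
  have Y: "cfun.subspace Y" "Y \<subseteq> X" "closedin (seminorm_topology X N) Y"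
    using assms(3) by (auto simp: closed_subspace_def)
  \<comment> \<open>Since \<open>Y\<close> lies in \<open>X\<close>, the condition
    \<open>T f \<in> Y\<close> already puts \<open>f\<close> in [T,X]; so [T,Y] is the full preimage
    of \<open>Y\<close> under \<open>T\<close> on [T,X].\<close>
  have "{f \<in> optimal_domain T X. T f \<in> Y} = optimal_domain T Y"
    using Y(2) by (auto simp: optimal_domain_def)
  then have "closedin (seminorm_topology (optimal_domain T X) (optimal_seminorm T N))
      (optimal_domain T Y)"
    using closedin_continuous_map_preimage[OF _ Y(3), of _ T]
      bounded_operator_on_optimal_domain[OF assms(1,2)]
    unfolding bounded_operator_on_def by (metis topspace_seminorm_topology)
  then show ?thesis
    using Y subspace_optimal_domain[OF assms(1)]
    by (auto simp: closed_subspace_def optimal_domain_def)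
qed

theorem proposition2p4:
  fixes X :: "(complex \<Rightarrow> complex) set"
    and N :: "(complex \<Rightarrow> complex) \<Rightarrow> real"
    and T :: "(complex \<Rightarrow> complex) \<Rightarrow> (complex \<Rightarrow> complex)"
  assumes "banach_space_analytic X N"
    and "operator_H_disc T"
    and "T ` X \<subseteq> X"
  shows "bounded_operator_on X N X N T
    \<and> seminormed_space (optimal_domain T X) (optimal_seminorm T N)
    \<and> optimal_domain T X \<subseteq> H_disc
    \<and> (inj_on T H_disc \<longrightarrow> normed_space (optimal_domain T X) (optimal_seminorm T N))
    \<and> (X \<subseteq> optimal_domain T X \<and>
        continuous_map (seminorm_topology X N)
          (seminorm_topology (optimal_domain T X) (optimal_seminorm T N)) (\<lambda>f. f))
    \<and> bounded_operator_on (optimal_domain T X) (optimal_seminorm T N) X N T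
    \<and> (\<forall>Y. closed_subspace Y X N \<and> T ` Y \<subseteq> Y \<longrightarrow>
          banach_space_analytic Y N \<and>
          closed_subspace (optimal_domain T Y) (optimal_domain T X) (optimal_seminorm T N))
    \<and> (kernel_on X T = X \<inter> kernel_on (optimal_domain T X) T \<and>
        X \<inter> kernel_on (optimal_domain T X) T \<subseteq> kernel_on (optimal_domain T X) T \<and>
        kernel_on (optimal_domain T X) T \<subseteq> kernel_on H_disc T)"
proof -
  have XH: "X \<subseteq> H_disc" and n: "normed_space X N"
    using assms(1) by (auto simp: banach_space_analytic_def)
  note sn = normed_space_imp_seminormed_space[OF n]
  have lin: "linear_on H_disc T"
    using assms(2) by (simp add: operator_H_disc_def)
  note linX = linear_on_subset[OF lin XH]
  obtain C where C: "\<And>f. f \<in> X \<Longrightarrow> N (T f) \<le> C * N f"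
    using operator_H_disc_bounded[OF assms] by blast
  have sub: "X \<subseteq> optimal_domain T X"
    using XH assms(3) by (auto simp: optimal_domain_def)
  have T_X: "bounded_operator_on X N X N T"
    unfolding bounded_operator_on_def
    by (intro conjI linX continuous_map_seminorm_bounded[OF sn linX assms(3), where C = C] C)
  \<comment> \<open>The estimate for \<open>T\<close> on \<open>X\<close> is reread as one for the
    identity map, whose target seminorm is \<open>N (T f)\<close>.\<close>
  have incl: "continuous_map (seminorm_topology X N)
      (seminorm_topology (optimal_domain T X) (optimal_seminorm T N)) (\<lambda>f. f)"
    by (rule continuous_map_seminorm_bounded[OF sn, where C = C])
      (use sub C in \<open>auto simp: linear_on_def optimal_seminorm_def\<close>)
  have closed: "\<forall>Y. closed_subspace Y X N \<and> T ` Y \<subseteq> Y \<longrightarrow> banach_space_analytic Y N \<and>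
      closed_subspace (optimal_domain T Y) (optimal_domain T X) (optimal_seminorm T N)"
    using closed_subspace_banach_space_analytic[OF assms(1)]
      closed_subspace_optimal_domain[OF lin sn] by blast
  have dom: "optimal_domain T X \<subseteq> H_disc"
    by (auto simp: optimal_domain_def)
  \<comment> \<open>All three kernels are cut out by \<open>T f = 0\<close>, so the relations follow
    from the inclusions of \<open>X\<close> in [T,X] and of [T,X] in H(D).\<close>
  have kernels: "kernel_on X T = X \<inter> kernel_on (optimal_domain T X) T"
      "kernel_on (optimal_domain T X) T \<subseteq> kernel_on H_disc T"
    using sub dom by (auto simp: kernel_on_def)
  show ?thesis
    by (intro conjI impI T_X sub incl closed dom kernels Int_lower2
        seminormed_space_optimal_domain[OF lin sn] normed_space_optimal_domain[OF lin n]
        bounded_operator_on_optimal_domain[OF lin sn])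
qed

end
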